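(* Let $\gamma>0$ and $C>0$ satisfy $\gamma C\ge 2$. Then for every $s\in\mathbb{R}$ the set $\mathrm{prox}_{\gamma C\ell_r}(s)$ is given by $$\mathrm{prox}_{\gamma C\ell_{r}}(s)=\begin{cases}\{s\},& s>\sqrt{2\gamma C},\\ \{s,\ 0\},& s=\sqrt{2\gamma C},\\ \{0\},& 0<s<\sqrt{2\gamma C},\\ \{s\},& s\le 0.\end{cases}$$
   Context: The ramp loss $\ell_r:\mathbb{R}\to\mathbb{R}$ is defined by $\ell_r(t)=1$ for $t\ge 1$, $\ell_r(t)=t$ for $0\le t<1$, and $\ell_r(t)=0$ for $t<0$. For $\gamma,C>0$ and $s\in\mathbb{R}$, the (set-valued) proximal operator of $\ell_r$ is the set of global minimizers $$\mathrm{prox}_{\gamma C\ell_r}(s)=\arg\min_{v\in\mathbb{R}}\ C\ell_r(v)+\frac{1}{2\gamma}(v-s)^2 .$$ *)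

theory Defs
  imports Complex_Main
begin

definition ramp_loss :: "real \<Rightarrow> real" where
  "ramp_loss t = (if t \<ge> 1 then 1 else if t \<ge> 0 then t else 0)"

definition prox :: "real \<Rightarrow> real \<Rightarrow> (real \<Rightarrow> real) \<Rightarrow> real \<Rightarrow> real set" where
  "prox \<gamma> C f s =
     {v. is_arg_min (\<lambda>v. C * f v + 1 / (2 * \<gamma>) * (v - s)\<^sup>2) (\<lambda>_. True) v}"

end

(* After scaling by 2 \<gamma> and writing r = sqrt (2 \<gamma> C), the objective becomes
   r^2 * ramp_loss v + (v - s)^2.  Its only candidate minimizers are 0 and s, with values s^2 and
   (for s >= 1) r^2, so they swap roles at s = r.  On the linear piece 0 < v < 1 the point v
   is beaten by 0 or s precisely because \<gamma> C >= 2 means r^2 >= 2 r. *)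
theory Submission
  imports Defs
begin

text \<open>Multiplying the objective by \<open>2 * \<gamma>\<close> > 0 keeps its minimizers and
  clears the division. The witness \<open>m\<close> ensures that the level \<open>c\<close> is
  attained, so that no point outside \<open>M\<close> can be a minimizer.\<close>

lemma prox_eqI:
  assumes "\<gamma> > 0" and "m \<in> M"
    and min: "\<And>v. v \<in> M \<Longrightarrow> 2 * \<gamma> * C * f v + (v - s)\<^sup>2 = c"
    and gt: "\<And>v. v \<notin> M \<Longrightarrow> c < 2 * \<gamma> * C * f v + (v - s)\<^sup>2"
  shows "prox \<gamma> C f s = M"
proof -
  define h where "h v = 2 * \<gamma> * C * f v + (v - s)\<^sup>2" for v
  have scale: "C * f v + 1 / (2 * \<gamma>) * (v - s)\<^sup>2 = h v / (2 * \<gamma>)" for v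
    using \<open>\<gamma> > 0\<close> by (simp add: h_def field_simps)
  have "prox \<gamma> C f s = {v. \<forall>w. \<not> h w < h v}"
    unfolding prox_def is_arg_min_def scale
    using \<open>\<gamma> > 0\<close> by (simp add: divide_less_cancel)
  also have "\<dots> = M"
  proof -
    have "h v = c" if "v \<in> M" for v
      using min[OF that] by (simp add: h_def)
    moreover have "c < h v" if "v \<notin> M" for v
      using gt[OF that] by (simp add: h_def)
    ultimately show ?thesis
      using \<open>m \<in> M\<close> by (auto simp: not_less) (metis less_le_not_le order_less_imp_le order_refl)+
  qed
  finally show ?thesis .
qed

text \<open>Here \<open>s\<^sup>2\<close> is the value at \<open>v = 0\<close>. The last hypothesis
  excludes only the tie at \<open>v = s = r\<close>.\<close>

lemma ramp_objective_gt_zero_value: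
  fixes r s v :: real
  assumes "2 \<le> r" "0 < s" "s \<le> r" "v \<noteq> 0" "s < r \<or> v \<noteq> s"
  shows "s\<^sup>2 < r\<^sup>2 * ramp_loss v + (v - s)\<^sup>2"
proof -
  consider "v < 0" | "0 < v" "v < 1" | "1 \<le> v"
    using \<open>v \<noteq> 0\<close> by linarith
  then show ?thesis
  proof cases
    case 1
    then have "0 < v\<^sup>2 + 2 * s * (- v)"
      using \<open>0 < s\<close> by (intro add_pos_pos mult_pos_pos) auto
    then show ?thesis
      using 1 by (simp add: ramp_loss_def power2_diff mult.commute mult.left_commute)
  next
    case 2
    \<comment> \<open>On the linear piece the excess over \<open>s\<^sup>2\<close> factors as
      \<open>v * (r\<^sup>2 - 2 * s + v)\<close>.\<close>
    have "2 * s \<le> r\<^sup>2"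
      using assms mult_right_mono[of 2 r r] unfolding power2_eq_square by linarith
    then have "0 < v * (r\<^sup>2 - 2 * s + v)"
      using 2 by (intro mult_pos_pos) auto
    then show ?thesis
      using 2 by (simp add: ramp_loss_def power2_eq_square algebra_simps)
  next
    case 3
    \<comment> \<open>On the plateau the loss term alone is at least \<open>s\<^sup>2\<close>;
      strictness comes from \<open>s < r\<close> or from \<open>v \<noteq> s\<close>.\<close>
    have "s\<^sup>2 < r\<^sup>2 \<or> 0 < (v - s)\<^sup>2"
      using assms by (auto intro: power_strict_mono)
    moreover have "s\<^sup>2 \<le> r\<^sup>2" "0 \<le> (v - s)\<^sup>2"
      using assms by (auto intro: power_mono)
    ultimately have "s\<^sup>2 < r\<^sup>2 + (v - s)\<^sup>2"
      by linarith
    then show ?thesis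
      using 3 by (simp add: ramp_loss_def)
  qed
qed

text \<open>Left of the plateau, \<open>v < 1 < r < s\<close>, so pulling the centre from
  \<open>s\<close> back to \<open>r\<close> strictly shortens the distance to \<open>v\<close>; at
  centre \<open>r\<close> the value \<open>r\<^sup>2\<close> of \<open>v = 0\<close> is already a
  lower bound.\<close>

lemma ramp_objective_gt_plateau_value:
  fixes r s v :: real
  assumes "2 \<le> r" "r < s" "v \<noteq> s"
  shows "r\<^sup>2 < r\<^sup>2 * ramp_loss v + (v - s)\<^sup>2"
proof -
  consider "v < 1" | "1 \<le> v" by linarith
  then show ?thesis
  proof cases
    case 1
    have "(r - v)\<^sup>2 < (s - v)\<^sup>2"
      using assms 1 by (intro power_strict_mono) auto
    moreover have "r\<^sup>2 \<le> r\<^sup>2 * ramp_loss v + (r - v)\<^sup>2"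
    proof (cases "v = 0")
      case False
      then show ?thesis
        using ramp_objective_gt_zero_value[of r r v] assms 1
        by (simp add: power2_commute)
    qed (simp add: ramp_loss_def)
    ultimately show ?thesis
      by (simp add: power2_commute)
  next
    case 2
    then show ?thesis
      using assms by (simp add: ramp_loss_def)
  qed
qed

theorem proposition2:
  fixes \<gamma> C :: real
  assumes "\<gamma> > 0" and "C > 0" and "\<gamma> * C \<ge> 2"
  shows "\<forall>s::real. prox \<gamma> C ramp_loss s =
    (if s > sqrt (2 * \<gamma> * C) then {s}
     else if s = sqrt (2 * \<gamma> * C) then {s, 0}
     else if 0 < s \<and> s < sqrt (2 * \<gamma> * C) then {0}
     else {s})"
proof
  fix s :: real
  define r where "r = sqrt (2 * \<gamma> * C)"
  have sq: "2 * \<gamma> * C = r\<^sup>2"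
    using assms by (simp add: r_def)
  have r: "2 \<le> r"
    \<comment> \<open>Squared, this is 4 \<le> \<open>2 * \<gamma> * C\<close>, that is,
      \<open>\<gamma> * C \<ge> 2\<close>.\<close>
    unfolding r_def using assms by (intro real_le_rsqrt) (simp add: mult.commute)
  have "prox \<gamma> C ramp_loss s =
    (if s > r then {s} else if s = r then {s, 0} else if 0 < s \<and> s < r then {0} else {s})"
  proof -
    consider "r < s" | "s = r" | "0 < s" "s < r" | "s \<le> 0"
      by linarith
    then show ?thesis
    proof cases
      case 1
      have "prox \<gamma> C ramp_loss s = {s}"
        using 1 r ramp_objective_gt_plateau_value[of r s]
        by (intro prox_eqI[where m = s and c = "r\<^sup>2"] assms) (auto simp: sq ramp_loss_def)
      then show ?thesis using 1 by simp
    next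
      case 2
      \<comment> \<open>The tie: \<open>v = s\<close> pays only the loss \<open>r\<^sup>2\<close>,
        \<open>v = 0\<close> only the distance \<open>s\<^sup>2\<close>.\<close>
      have "prox \<gamma> C ramp_loss s = {s, 0}"
        using 2 r ramp_objective_gt_zero_value[of r s]
        by (intro prox_eqI[where m = s and c = "s\<^sup>2"] assms) (auto simp: sq ramp_loss_def)
      then show ?thesis using 2 by simp
    next
      case 3
      have "prox \<gamma> C ramp_loss s = {0}"
        using 3 r ramp_objective_gt_zero_value[of r s]
        by (intro prox_eqI[where m = 0 and c = "s\<^sup>2"] assms) (auto simp: sq ramp_loss_def)
      then show ?thesis using 3 by simp
    next
      case 4
      have "prox \<gamma> C ramp_loss s = {s}"
      \<comment> \<open>For \<open>s \<le> 0\<close> both nonnegative terms vanish at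
        \<open>v = s\<close>.\<close>
      proof (intro prox_eqI[where m = s and c = 0] assms)
        fix v assume "v \<notin> {s}"
        moreover have "0 \<le> r\<^sup>2 * ramp_loss v"
          by (simp add: ramp_loss_def)
        ultimately show "0 < 2 * \<gamma> * C * ramp_loss v + (v - s)\<^sup>2"
          unfolding sq by (intro add_nonneg_pos) auto
      qed (use 4 in \<open>auto simp: ramp_loss_def\<close>)
      then show ?thesis using 4 r by simp
    qed
  qed
  then show "prox \<gamma> C ramp_loss s =
    (if s > sqrt (2 * \<gamma> * C) then {s}
     else if s = sqrt (2 * \<gamma> * C) then {s, 0}
     else if 0 < s \<and> s < sqrt (2 * \<gamma> * C) then {0}
     else {s})"
    by (simp only: r_def)
qed

end
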